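(* Let $\mu_1,\mu_2$ be sub-distributions over countable sets $A_1,A_2$, let $R\subseteq A_1\times A_2$, and let $\varepsilon,\delta$ be reals. If there is an $(\varepsilon,\delta)$-approximate lifting of $R$ relating $\mu_1$ and $\mu_2$, then for every subset $S_1\subseteq A_1$, $\mu_1(S_1)\le e^{\varepsilon}\mu_2(R(S_1))+\delta$, where $R(S_1)=\{a_2\in A_2:\exists a_1\in S_1,\,(a_1,a_2)\in R\}$.
   Context: A sub-distribution over a countable set $A$ is $\mu:A\to[0,1]$ with $\sum_a\mu(a)\le1$; $\mu(X)=\sum_{a\in X}\mu(a)$; marginals of $\mu$ over $A_1\times A_2$ are $\pi_1(\mu)(a_1)=\sum_{a_2}\mu(a_1,a_2)$, $\pi_2(\mu)(a_2)=\sum_{a_1}\mu(a_1,a_2)$. $d_\varepsilon(\nu_1,\nu_2)=\max_{X}(\nu_1(X)-e^{\varepsilon}\nu_2(X))$. With a fresh element $\star$, $A^\star=A\cup\{\star\}$ and $R^\star=R\cup(A_1\times\{\star\})\cup(\{\star\}\times A_2)$. An $(\varepsilon,\delta)$-approximate $R$-lifting of $(\mu_1,\mu_2)$ exists if there are sub-distributions $\mu_L,\mu_R$ over $A_1^\star\times A_2^\star$ with $\pi_1(\mu_L)=\mu_1$, $\pi_2(\mu_R)=\mu_2$ (with $\mu_i(\star)=0$), $\mathrm{supp}(\mu_L)\cup\mathrm{supp}(\mu_R)\subseteq R^\star$, and $d_\varepsilon(\mu_L,\mu_R)\le\delta$. *)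

theory Defs
  imports "HOL-Probability.Probability"
begin

text \<open>
  A sub-distribution over a countable set \<open>A\<close> is an element \<open>\<mu>\<close> of the library type \<open>'a spmf\<close> with
  \<open>set_spmf \<mu> \<subseteq> A\<close>: the value of \<open>\<mu>\<close> at \<open>a\<close> is \<open>spmf \<mu> a\<close>, the mass \<open>\<mu>(X)\<close> is
  \<open>measure (measure_spmf \<mu>) X\<close>, and the marginals are \<open>map_spmf fst \<mu>\<close> and \<open>map_spmf snd \<mu>\<close>.
\<close>

definition sub_distribution_on :: "'a set \<Rightarrow> 'a spmf \<Rightarrow> bool" where
  "sub_distribution_on A \<mu> \<longleftrightarrow> set_spmf \<mu> \<subseteq> A"

abbreviation mass :: "'a spmf \<Rightarrow> 'a set \<Rightarrow> real" where
  "mass \<mu> X \<equiv> measure (measure_spmf \<mu>) X"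

lemma mass_summable_and_infsum:
  "spmf \<mu> summable_on X \<and> mass \<mu> X = (\<Sum>\<^sub>\<infinity>a\<in>X. spmf \<mu> a)"
proof -
  have "Infinite_Set_Sum.abs_summable_on (pmf \<mu>) (Some ` X)"
    by (rule pmf_abs_summable)
  then have s: "Infinite_Set_Sum.abs_summable_on (spmf \<mu>) X"
    using abs_summable_on_reindex_iff[of Some X "pmf \<mu>"] by simp
  have "mass \<mu> X = infsetsum (pmf \<mu>) (Some ` X)"
    by (simp add: measure_measure_spmf_conv_measure_pmf measure_pmf_conv_infsetsum)
  also have "\<dots> = infsetsum (spmf \<mu>) X"
    by (subst infsetsum_reindex) auto
  also have "\<dots> = (\<Sum>\<^sub>\<infinity>a\<in>X. spmf \<mu> a)"
    by (rule infsetsum_infsum[OF s])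
  finally show ?thesis
    using abs_summable_summable[OF s[unfolded abs_summable_equivalent[symmetric]]] by simp
qed

lemma mass_eq_infsum: "mass \<mu> X = (\<Sum>\<^sub>\<infinity>a\<in>X. spmf \<mu> a)"
  by (simp add: mass_summable_and_infsum)

lemma marginal_eq_infsum:
  "spmf (map_spmf fst \<mu>) a = (\<Sum>\<^sub>\<infinity>b. spmf \<mu> (a, b))"
  "spmf (map_spmf snd \<mu>) b = (\<Sum>\<^sub>\<infinity>a. spmf \<mu> (a, b))"
proof -
  have 1: "fst -` {a} = range (Pair a)" and 2: "snd -` {b} = range (\<lambda>a. (a, b))"
    by auto
  show "spmf (map_spmf fst \<mu>) a = (\<Sum>\<^sub>\<infinity>b. spmf \<mu> (a, b))"
    unfolding spmf_map mass_eq_infsum 1 by (subst infsum_reindex) (auto simp: inj_on_def o_def)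
  show "spmf (map_spmf snd \<mu>) b = (\<Sum>\<^sub>\<infinity>a. spmf \<mu> (a, b))"
    unfolding spmf_map mass_eq_infsum 2 by (subst infsum_reindex) (auto simp: inj_on_def o_def)
qed

text \<open>The supremum is attained, so it is the maximum; see \<open>eps_distance_is_max\<close> below.\<close>

definition eps_distance :: "'a set \<Rightarrow> real \<Rightarrow> 'a spmf \<Rightarrow> 'a spmf \<Rightarrow> real" where
  "eps_distance A \<epsilon> \<nu>1 \<nu>2 = (SUP X\<in>Pow A. mass \<nu>1 X - exp \<epsilon> * mass \<nu>2 X)"

lemma eps_distance_is_max:
  "\<exists>X\<subseteq>A. eps_distance A \<epsilon> \<nu>1 \<nu>2 = mass \<nu>1 X - exp \<epsilon> * mass \<nu>2 X \<and>
     (\<forall>Y\<subseteq>A. mass \<nu>1 Y - exp \<epsilon> * mass \<nu>2 Y \<le> mass \<nu>1 X - exp \<epsilon> * mass \<nu>2 X)"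
proof -
  define f where "f X = mass \<nu>1 X - exp \<epsilon> * mass \<nu>2 X" for X
  define X0 where "X0 = {x\<in>A. spmf \<nu>1 x > exp \<epsilon> * spmf \<nu>2 x}"
  have summ: "spmf \<nu> summable_on X" for \<nu> :: "'a spmf" and X
    using mass_summable_and_infsum[of \<nu> X] by simp
  have f_infsum: "f X = (\<Sum>\<^sub>\<infinity>a\<in>X. spmf \<nu>1 a) - (\<Sum>\<^sub>\<infinity>a\<in>X. exp \<epsilon> * spmf \<nu>2 a)" for X
    by (simp add: f_def mass_eq_infsum infsum_cmult_right')
  have neg: "f X \<le> 0" if "\<And>x. x \<in> X \<Longrightarrow> spmf \<nu>1 x \<le> exp \<epsilon> * spmf \<nu>2 x" for X
    unfolding f_infsum diff_le_0_iff_le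
    by (rule infsum_mono[OF summ summable_on_cmult_right[OF summ] that])
  have pos: "f X \<ge> 0" if "X \<subseteq> X0" for X
    unfolding f_infsum diff_ge_0_iff_ge
    by (rule infsum_mono[OF summable_on_cmult_right[OF summ] summ]) (use that in \<open>auto simp: X0_def\<close>)
  have add: "f (X \<union> Y) = f X + f Y" if "X \<inter> Y = {}" for X Y
    using that by (simp add: f_def measure_spmf.finite_measure_Union algebra_simps)
  have max: "f Y \<le> f X0" if "Y \<subseteq> A" for Y
  proof -
    have "f Y = f (Y \<inter> X0) + f (Y - X0)"
      using add[of "Y \<inter> X0" "Y - X0"] by (simp add: Int_Diff_disjoint Int_Diff_Un)
    moreover have "f X0 = f (Y \<inter> X0) + f (X0 - Y)"
      using add[of "Y \<inter> X0" "X0 - Y"] by (metis Int_Diff_Un Int_Diff_disjoint Int_commute)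
    moreover have "f (Y - X0) \<le> 0" using that by (intro neg) (auto simp: X0_def)
    moreover have "f (X0 - Y) \<ge> 0" by (intro pos) auto
    ultimately show ?thesis by linarith
  qed
  have "X0 \<subseteq> A" by (auto simp: X0_def)
  moreover from this have "(SUP X\<in>Pow A. f X) = f X0"
    using max by (intro cSup_eq_maximum) auto
  ultimately show ?thesis
    using max unfolding eps_distance_def f_def by blast
qed

text \<open>The fresh element \<open>\<star>\<close> is \<open>None\<close>, and \<open>Some\<close> embeds the original set. (It is unrelated to the
  \<open>None\<close> that carries the missing mass inside the type \<open>'a spmf = 'a option pmf\<close>.)\<close>

definition star_set :: "'a set \<Rightarrow> 'a option set" where
  "star_set A = insert None (Some ` A)"

definition star_rel :: "'a set \<Rightarrow> 'b set \<Rightarrow> ('a \<times> 'b) set \<Rightarrow> ('a option \<times> 'b option) set" where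
  "star_rel A1 A2 R =
     map_prod Some Some ` R \<union> (Some ` A1) \<times> {None} \<union> {None} \<times> (Some ` A2)"

text \<open>The marginal conditions use \<open>map_spmf Some \<mu>\<^sub>i\<close>, which is \<open>\<mu>\<^sub>i\<close> extended by \<open>0\<close> at \<open>\<star>\<close>.\<close>

definition approximate_lifting ::
  "'a set \<Rightarrow> 'b set \<Rightarrow> ('a \<times> 'b) set \<Rightarrow> real \<Rightarrow> real \<Rightarrow> 'a spmf \<Rightarrow> 'b spmf \<Rightarrow> bool" where
  "approximate_lifting A1 A2 R \<epsilon> \<delta> \<mu>1 \<mu>2 \<longleftrightarrow>
     (\<exists>\<mu>L \<mu>R. sub_distribution_on (star_set A1 \<times> star_set A2) \<mu>L \<and>
        sub_distribution_on (star_set A1 \<times> star_set A2) \<mu>R \<and>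
        map_spmf fst \<mu>L = map_spmf Some \<mu>1 \<and>
        map_spmf snd \<mu>R = map_spmf Some \<mu>2 \<and>
        set_spmf \<mu>L \<union> set_spmf \<mu>R \<subseteq> star_rel A1 A2 R \<and>
        eps_distance (star_set A1 \<times> star_set A2) \<epsilon> \<mu>L \<mu>R \<le> \<delta>)"

end

theory Submission
  imports Defs
begin

text \<open>
  Compare the two witnesses on the part of \<open>R\<^sup>\<star>\<close> lying above \<open>S\<^sub>1\<close>. It carries all the mass that
  \<open>\<mu>\<^sub>L\<close> projects onto \<open>S\<^sub>1\<close>, and its second components lie in \<open>R(S\<^sub>1) \<union> {\<star>}\<close>, where \<open>\<star>\<close> has no
  mass under the second marginal \<open>\<mu>\<^sub>2\<close> of \<open>\<mu>\<^sub>R\<close>.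
\<close>

text \<open>The supremum defining \<open>eps_distance\<close> is attained, hence a genuine upper
  bound over the subsets of \<open>A\<close>.\<close>

lemma mass_le_eps_distance:
  assumes "X \<subseteq> A"
  shows "mass \<nu>1 X \<le> exp \<epsilon> * mass \<nu>2 X + eps_distance A \<epsilon> \<nu>1 \<nu>2"
  using eps_distance_is_max[of A \<epsilon> \<nu>1 \<nu>2] assms by (metis add.commute diff_le_eq)

lemma mass_mono_on_support:
  assumes "X \<inter> set_spmf \<mu> \<subseteq> Y"
  shows "mass \<mu> X \<le> mass \<mu> Y"
  using assms by (intro measure_spmf.finite_measure_mono_AE) auto

text \<open>Turns a marginal equation into an equality of masses. With \<open>g = Some\<close>, the
  preimage on the right discards \<open>None\<close>.\<close>

lemma mass_vimage_eq:
  assumes "map_spmf f \<nu> = map_spmf g \<mu>"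
  shows "mass \<nu> (f -` X) = mass \<mu> (g -` X)"
  using arg_cong[OF assms, of "\<lambda>\<nu>. mass \<nu> X"] by (simp only: measure_map_spmf)

theorem theorem5p2:
  fixes A1 :: "'a set" and A2 :: "'b set"
    and \<mu>1 :: "'a spmf" and \<mu>2 :: "'b spmf"
    and R :: "('a \<times> 'b) set"
    and \<epsilon> \<delta> :: real
  assumes "countable A1" and "countable A2"
    and "sub_distribution_on A1 \<mu>1" and "sub_distribution_on A2 \<mu>2"
    and "R \<subseteq> A1 \<times> A2"
    and "approximate_lifting A1 A2 R \<epsilon> \<delta> \<mu>1 \<mu>2"
  shows "\<forall>S1\<subseteq>A1. mass \<mu>1 S1 \<le> exp \<epsilon> * mass \<mu>2 {a2\<in>A2. \<exists>a1\<in>S1. (a1, a2) \<in> R} + \<delta>"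
proof (intro allI impI)
  fix S1 assume S1: "S1 \<subseteq> A1"
  define T where "T = {a2\<in>A2. \<exists>a1\<in>S1. (a1, a2) \<in> R}"
  let ?A = "star_set A1 \<times> star_set A2"
  obtain \<mu>L \<mu>R where
    L: "map_spmf fst \<mu>L = map_spmf Some \<mu>1" "set_spmf \<mu>L \<subseteq> star_rel A1 A2 R" and
    R: "map_spmf snd \<mu>R = map_spmf Some \<mu>2" and
    d: "eps_distance ?A \<epsilon> \<mu>L \<mu>R \<le> \<delta>"
    using assms(6) unfolding approximate_lifting_def by auto
  \<comment> \<open>Cutting down to \<open>star_rel\<close> loses no mass of \<open>\<mu>L\<close>,
    whose support lies there, and restricts the second components.\<close>
  define X where "X = fst -` Some ` S1 \<inter> star_rel A1 A2 R"
  have "X \<subseteq> ?A"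
    using assms(5) by (auto simp: X_def star_rel_def star_set_def)
  have "mass \<mu>1 S1 = mass \<mu>L (fst -` Some ` S1)"
    using mass_vimage_eq[OF L(1), of "Some ` S1"] by (simp add: inj_vimage_image_eq)
  also have "\<dots> \<le> mass \<mu>L X"
    using L(2) by (intro mass_mono_on_support) (auto simp: X_def)
  also have "\<dots> \<le> exp \<epsilon> * mass \<mu>R X + \<delta>"
    using mass_le_eps_distance[OF \<open>X \<subseteq> ?A\<close>, of \<mu>L \<epsilon> \<mu>R] d by linarith
  finally have bound: "mass \<mu>1 S1 \<le> exp \<epsilon> * mass \<mu>R X + \<delta>" .
  \<comment> \<open>The first component is some \<open>Some a1\<close> with \<open>a1\<close> in
    \<open>S1\<close>, so the pairs with first component \<open>None\<close> are excluded; the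
    others end in \<open>None\<close> or in an \<open>R\<close>-successor of
    \<open>a1\<close>.\<close>
  have "X \<subseteq> snd -` insert None (Some ` T)"
    using assms(5) by (fastforce simp: X_def star_rel_def T_def)
  then have "mass \<mu>R X \<le> mass \<mu>R (snd -` insert None (Some ` T))"
    by (intro mass_mono_on_support) auto
  also have "\<dots> = mass \<mu>2 (Some -` insert None (Some ` T))"
    by (rule mass_vimage_eq[OF R])
  also have "Some -` insert None (Some ` T) = T"
    by auto
  finally have "exp \<epsilon> * mass \<mu>R X \<le> exp \<epsilon> * mass \<mu>2 T"
    by simp
  with bound show "mass \<mu>1 S1 \<le> exp \<epsilon> * mass \<mu>2 {a2\<in>A2. \<exists>a1\<in>S1. (a1, a2) \<in> R} + \<delta>"
    unfolding T_def by linarith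
qed

end
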